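(* We have $h(-3)=h(-4)=1$. Suppose $D\equiv 0,1\pmod 4$ and $D<-4$. Put $n:=|D|$ if $D$ is odd and $n:=|D|/4$ if $D$ is even. Then $$h(D)=2\sum_{\substack{e>f>g>0\\ ef+eg+fg=n}}1+\sum_{\substack{e,f>0\\ e^2+2ef=n}}1+\sum_{\substack{e>f>0\\ ef=n}}1,$$ where all sums are over pairs or triples of integers whose gcd is $1$; in the first two sums the pairs or triples are required to be all odd if $D$ is odd, and not all odd if $D$ is even; and the last sum is included only when $D$ is even.
   Context: A binary quadratic form is $q=[a,b,c]=ax^2+bxy+cy^2$ with $a,b,c\in\mathbb{Z}$, of discriminant $D=b^2-4ac$; it is primitive if $\gcd(a,b,c)=1$. For $M=\begin{pmatrix}\alpha&\beta\\\gamma&\delta\end{pmatrix}$ put $q|M(x,y)=q(\alpha x+\beta y,\gamma x+\delta y)$; forms $q_1,q_2$ are equivalent if $q_1=q_2|M$ for some $M\in\mathrm{SL}(2,\mathbb{Z})$. For $D\le 0$, $h(D)$ is the number of equivalence classes of primitive forms of discriminant $D$ with $a,c\ge0$ (i.e. representing only nonnegative integers). *)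

theory Defs
  imports "HOL-Analysis.Analysis"
begin

text \<open>\<^term>\<open>Form a b c\<close> is the binary quadratic form $[a,b,c] = ax^2 + bxy + cy^2$.\<close>

datatype bqf = Form int int int

fun form_eval :: "bqf \<Rightarrow> int \<Rightarrow> int \<Rightarrow> int" where
  "form_eval (Form a b c) x y = a * x\<^sup>2 + b * x * y + c * y\<^sup>2"

fun discriminant :: "bqf \<Rightarrow> int" where
  "discriminant (Form a b c) = b\<^sup>2 - 4 * a * c"

fun primitive_form :: "bqf \<Rightarrow> bool" where
  "primitive_form (Form a b c) \<longleftrightarrow> gcd a (gcd b c) = 1"

fun outer_coeffs_nonneg :: "bqf \<Rightarrow> bool" where
  "outer_coeffs_nonneg (Form a b c) \<longleftrightarrow> a \<ge> 0 \<and> c \<ge> 0"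

text \<open>The form $q|M$, by its coefficients; these are obtained by expanding
  $q(\alpha x + \beta y, \gamma x + \delta y)$, see \<open>form_eval_form_act\<close> below.\<close>

fun form_act :: "bqf \<Rightarrow> int^2^2 \<Rightarrow> bqf" where
  "form_act (Form a b c) M =
     (let \<alpha> = M $ 1 $ 1; \<beta> = M $ 1 $ 2; \<gamma> = M $ 2 $ 1; \<delta> = M $ 2 $ 2 in
      Form (a * \<alpha>\<^sup>2 + b * \<alpha> * \<gamma> + c * \<gamma>\<^sup>2)
           (2 * a * \<alpha> * \<beta> + b * (\<alpha> * \<delta> + \<beta> * \<gamma>) + 2 * c * \<gamma> * \<delta>)
           (a * \<beta>\<^sup>2 + b * \<beta> * \<delta> + c * \<delta>\<^sup>2))"

lemma form_eval_form_act:
  "form_eval (form_act q M) x y =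
     form_eval q (M $ 1 $ 1 * x + M $ 1 $ 2 * y) (M $ 2 $ 1 * x + M $ 2 $ 2 * y)"
  by (cases q) (simp add: Let_def power2_eq_square algebra_simps)

lemma form_eval_inject: "form_eval q = form_eval r \<longleftrightarrow> q = r"
proof
  assume *: "form_eval q = form_eval r"
  obtain a b c a' b' c' where qr: "q = Form a b c" "r = Form a' b' c'"
    by (cases q, cases r) auto
  have "form_eval q 1 0 = form_eval r 1 0" "form_eval q 0 1 = form_eval r 0 1"
       "form_eval q 1 1 = form_eval r 1 1"
    using * by simp_all
  then show "q = r" by (simp add: qr)
qed simp

definition form_equiv :: "(bqf \<times> bqf) set" where
  "form_equiv = {(q1, q2). \<exists>M :: int^2^2. det M = 1 \<and> q1 = form_act q2 M}"

text \<open>Only meant for \<^term>\<open>D \<le> 0\<close>. The cardinality is taken in \<^typ>\<open>nat\<close>, so it would be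
  0 if there were infinitely many classes.\<close>

definition class_number :: "int \<Rightarrow> nat" where
  "class_number D =
     card ({q. discriminant q = D \<and> primitive_form q \<and> outer_coeffs_nonneg q} // form_equiv)"

end

theory Submission
  imports Defs
begin

text \<open>
  Every class contains exactly one reduced form $[a,b,c]$, i.e. one with $-a < b \le a \le c$ and
  $b \ge 0$ if $a = c$. Write the form (or its double, if $D$ is odd) as $f x^2 + e y^2 + g (x + y)^2$
  with $e, f, g$ its Selling parameters: the reduced forms with $b \ge 0$ then correspond to the triples
  $e \ge f \ge g \ge 0$ with $ef + eg + fg = n$. The remaining reduced forms are the $[a,-b,c]$
  for $0 < b < a < c$, that is, for $e > f > g > 0$, so that these triples count twice. The other
  triples have either two equal positive entries or $g = 0$.
\<close>

section \<open>Properness of the equivalence relation on forms\<close>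

definition mat2 :: "int \<Rightarrow> int \<Rightarrow> int \<Rightarrow> int \<Rightarrow> int^2^2" where
  "mat2 p q r s = vector [vector [p, q], vector [r, s]]"

lemma mat2_nth [simp]:
  "mat2 p q r s $ 1 $ 1 = p" "mat2 p q r s $ 1 $ 2 = q"
  "mat2 p q r s $ 2 $ 1 = r" "mat2 p q r s $ 2 $ 2 = s"
  by (simp_all add: mat2_def)

lemma det_mat2 [simp]: "det (mat2 p q r s) = p * s - q * r"
  by (simp add: det_2)

lemma form_act_mat_mult: "form_act q (M ** N) = form_act (form_act q M) N"
  by (cases q)
    (simp add: Let_def matrix_matrix_mult_def sum_2 power2_eq_square algebra_simps)

lemma form_act_mat_1: "form_act q (mat 1) = q"
  by (cases q) (simp add: Let_def mat_def)

lemma form_equivI: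
  assumes "p * s - q * r = (1::int)" and "f = form_act g (mat2 p q r s)"
  shows "(f, g) \<in> form_equiv"
  using assms unfolding form_equiv_def by (auto intro!: exI[of _ "mat2 p q r s"])

lemma form_equivE:
  assumes "(Form a' b' c', Form a b c) \<in> form_equiv"
  obtains p q r s :: int where "p * s - q * r = 1"
    and "a' = a * p\<^sup>2 + b * p * r + c * r\<^sup>2"
    and "b' = 2 * a * p * q + b * (p * s + q * r) + 2 * c * r * s"
    and "c' = a * q\<^sup>2 + b * q * s + c * s\<^sup>2"
  using assms unfolding form_equiv_def by (auto simp: det_2 Let_def)

lemma equiv_form_equiv: "equiv UNIV form_equiv"
proof (rule equivI)
  show "refl form_equiv"
    by (auto simp: refl_on_def form_equiv_def intro!: exI[of _ "mat 1"] simp: form_act_mat_1)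
  show "sym form_equiv"
  proof (rule symI)
    fix f g assume "(f, g) \<in> form_equiv"
    then obtain M :: "int^2^2" where M: "det M = 1" "f = form_act g M"
      by (auto simp: form_equiv_def)
    \<comment> \<open>The adjugate of \<open>M\<close>, which is its inverse because
      \<open>det M = 1\<close>.\<close>
    let ?N = "mat2 (M$2$2) (- M$1$2) (- M$2$1) (M$1$1)"
    have "M ** ?N = mat 1"
      using M(1) by (simp add: vec_eq_iff forall_2 matrix_matrix_mult_def sum_2 mat_def det_2 algebra_simps)
    then have "form_act f ?N = g"
      using M(2) by (metis form_act_mat_mult form_act_mat_1)
    then show "(g, f) \<in> form_equiv"
      using M(1)
      by (intro form_equivI[of "M$2$2" "M$1$1" "- M$1$2" "- M$2$1"]) (auto simp: det_2 mult.commute)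
  qed
  show "trans form_equiv"
  proof (rule transI)
    fix f g h assume "(f, g) \<in> form_equiv" "(g, h) \<in> form_equiv"
    then obtain M N :: "int^2^2" where "det M = 1" "f = form_act g M" "det N = 1" "g = form_act h N"
      by (auto simp: form_equiv_def)
    then have "det (N ** M) = 1 \<and> f = form_act h (N ** M)"
      by (simp add: det_mul form_act_mat_mult)
    then show "(f, h) \<in> form_equiv"
      by (auto simp: form_equiv_def)
  qed
qed auto

lemma form_equiv_sym: "(f, g) \<in> form_equiv \<Longrightarrow> (g, f) \<in> form_equiv"
  using equiv_form_equiv by (meson equivE symE)

lemma form_equiv_trans: "(f, g) \<in> form_equiv \<Longrightarrow> (g, h) \<in> form_equiv \<Longrightarrow> (f, h) \<in> form_equiv"
  using equiv_form_equiv by (meson equivE transE)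

section \<open>The forms of discriminant \<open>D\<close> and their invariance under
  equivalence\<close>

definition forms :: "int \<Rightarrow> bqf set" where
  "forms D = {q. discriminant q = D \<and> primitive_form q \<and> outer_coeffs_nonneg q}"

lemma discriminant_form_act: "discriminant (form_act q M) = discriminant q * (det M)\<^sup>2"
  by (cases q) (simp add: Let_def det_2 power2_eq_square algebra_simps)

text \<open>In terms of common divisors, primitivity can be carried through linear substitutions
  without computing any gcd.\<close>

lemma primitive_form_iff:
  "primitive_form (Form a b c) \<longleftrightarrow> (\<forall>d. d dvd a \<and> d dvd b \<and> d dvd c \<longrightarrow> is_unit d)"
  (is "_ \<longleftrightarrow> ?R")
proof
  assume "primitive_form (Form a b c)"
  then have "gcd a (gcd b c) = 1" by simp
  then show ?R by (metis gcd_greatest)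
next
  assume ?R
  then have "is_unit (gcd a (gcd b c))"
    by (meson dvd_trans gcd_dvd1 gcd_dvd2)
  then show "primitive_form (Form a b c)" by simp
qed

text \<open>By completing the square, \<open>f\<close> takes only nonnegative values, and the outer
  coefficients of \<open>g\<close> are values of \<open>f\<close>. A common divisor of the
  coefficients of \<open>g\<close> also divides those of \<open>f\<close>, which are integer
  combinations of them.\<close>

lemma forms_closed:
  assumes "(f, g) \<in> form_equiv" "f \<in> forms D" "D < 0"
  shows "g \<in> forms D"
proof -
  obtain a b c a' b' c' where fg: "f = Form a b c" "g = Form a' b' c'"
    by (cases f, cases g)
  have "discriminant g = D"
    using assms unfolding form_equiv_def forms_def by (auto simp: discriminant_form_act)
  have "(Form a' b' c', Form a b c) \<in> form_equiv"
    using assms(1) fg by (simp add: form_equiv_sym)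
  then obtain p q r s where pqrs: "a' = a * p\<^sup>2 + b * p * r + c * r\<^sup>2"
      "b' = 2 * a * p * q + b * (p * s + q * r) + 2 * c * r * s"
      "c' = a * q\<^sup>2 + b * q * s + c * s\<^sup>2"
    by (rule form_equivE)
  have D: "b\<^sup>2 - 4 * a * c = D" and ac: "a \<ge> 0" "c \<ge> 0"
    using assms(2) by (auto simp: forms_def fg)
  have "a > 0"
    using ac D \<open>D < 0\<close> by (cases "a = 0") auto
  have nonneg: "a * x\<^sup>2 + b * x * y + c * y\<^sup>2 \<ge> 0" for x y :: int
  proof -
    have "4 * a * (a * x\<^sup>2 + b * x * y + c * y\<^sup>2) = (2 * a * x + b * y)\<^sup>2 - D * y\<^sup>2"
      unfolding D[symmetric] by (simp add: power2_eq_square algebra_simps)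
    also have "\<dots> \<ge> 0"
      using \<open>D < 0\<close> by (smt (verit) mult_nonneg_nonneg mult_minus_left zero_le_power2)
    finally show ?thesis
      using \<open>a > 0\<close> by (simp add: zero_le_mult_iff)
  qed
  have "primitive_form g"
    unfolding fg primitive_form_iff
  proof (intro allI impI, elim conjE)
    fix d assume d: "d dvd a'" "d dvd b'" "d dvd c'"
    from assms(1) fg obtain p q r s where "a = a' * p\<^sup>2 + b' * p * r + c' * r\<^sup>2"
      "b = 2 * a' * p * q + b' * (p * s + q * r) + 2 * c' * r * s"
      "c = a' * q\<^sup>2 + b' * q * s + c' * s\<^sup>2"
      by (metis form_equivE)
    then have "d dvd a" "d dvd b" "d dvd c"
      using d by (auto intro!: dvd_add intro: dvd_mult dvd_mult2)
    moreover have "primitive_form (Form a b c)"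
      using assms(2) by (simp add: forms_def fg)
    ultimately show "is_unit d"
      unfolding primitive_form_iff by blast
  qed
  then show ?thesis
    using \<open>discriminant g = D\<close> nonneg pqrs by (simp add: forms_def fg)
qed

section \<open>Reduction theory: existence and uniqueness of the reduced form in a class\<close>

text \<open>The strict lower bound selects \<open>[a,a,c]\<close> from the equivalent pair
  \<open>[a,a,c]\<close>, \<open>[a,-a,c]\<close>; the condition for \<open>a = c\<close> selects
  one of \<open>[a,b,a]\<close>, \<open>[a,-b,a]\<close>.\<close>

fun reduced_form :: "bqf \<Rightarrow> bool" where
  "reduced_form (Form a b c) \<longleftrightarrow> - a < b \<and> b \<le> a \<and> a \<le> c \<and> (a = c \<longrightarrow> b \<ge> 0)"

lemma form_swap: "(Form c (- b) a, Form a b c) \<in> form_equiv"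
  \<comment> \<open>The entries are instantiated in the order \<open>p\<close>, \<open>s\<close>,
    \<open>q\<close>, \<open>r\<close>, so this is the substitution x -> -y, y -> x; in
    \<open>form_shift\<close> below it is x -> x + k y.\<close>
  by (rule form_equivI[of 0 0 "-1" 1]) (auto simp: Let_def)

lemma form_shift: "(Form a (b + 2 * a * k) (a * k\<^sup>2 + b * k + c), Form a b c) \<in> form_equiv"
  by (rule form_equivI[of 1 1 k 0]) (auto simp: Let_def)

text \<open>A form in the class that minimises \<open>2 * a + c\<close> is reduced up to the
  boundary cases: comparison with its shifts by 1 and -1 gives \<open>\<bar>b\<bar> \<le> a\<close>,
  comparison with its swap gives \<open>a \<le> c\<close>. One more shift or swap settles
  \<open>b = - a\<close> and \<open>a = c\<close>, \<open>b < 0\<close>.\<close>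

lemma exists_reduced:
  assumes "f \<in> forms D" "D < 0"
  shows "\<exists>g \<in> forms D. reduced_form g \<and> (f, g) \<in> form_equiv"
proof -
  \<comment> \<open>The weight 2 makes the swap informative:
    \<open>2 * a + c \<le> 2 * c + a\<close> means \<open>a \<le> c\<close>, while
    \<open>a + c\<close> would not change.\<close>
  define m where "m = (\<lambda>q. case q of Form a b c \<Rightarrow> nat (2 * a + c))"
  have "(f, f) \<in> form_equiv"
    using equiv_form_equiv by (simp add: equiv_def refl_on_def)
  then obtain q where q: "(f, q) \<in> form_equiv" "\<And>r. (f, r) \<in> form_equiv \<Longrightarrow> m q \<le> m r"
    using ex_has_least_nat[of "\<lambda>q. (f, q) \<in> form_equiv" f m] by blast
  obtain a b c where abc: "q = Form a b c" by (cases q)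
  have equivI: "(f, r) \<in> form_equiv" if "(r, q) \<in> form_equiv" for r
    using that q(1) by (meson form_equiv_sym form_equiv_trans)
  have inD: "r \<in> forms D" if "(f, r) \<in> form_equiv" for r
    using that assms forms_closed by blast
  have ac: "a \<ge> 0" "c \<ge> 0" and D: "b\<^sup>2 - 4 * a * c = D"
    using inD[OF q(1)] by (auto simp: forms_def abc)
  have "a > 0"
    using ac D \<open>D < 0\<close> by (cases "a = 0") auto
  have shift_equiv: "(f, Form a (b + 2 * a * k) (a * k\<^sup>2 + b * k + c)) \<in> form_equiv" for k
    using form_shift abc by (intro equivI) simp
  have shift: "a * k\<^sup>2 + b * k \<ge> 0" for k
    using q(2)[OF shift_equiv, of k] inD[OF shift_equiv, of k] ac
    by (simp add: forms_def m_def abc nat_le_eq_zle)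
  have "\<bar>b\<bar> \<le> a"
    using shift[of 1] shift[of "-1"] by auto
  have swap_equiv: "(f, Form c (- b) a) \<in> form_equiv"
    using form_swap abc by (intro equivI) simp
  have "a \<le> c"
    using q(2)[OF swap_equiv] ac by (simp add: m_def abc)
  consider "reduced_form q" | "b = - a" | "a = c" "b < 0"
    using \<open>\<bar>b\<bar> \<le> a\<close> \<open>a \<le> c\<close> abc by fastforce
  then have "\<exists>g. reduced_form g \<and> (f, g) \<in> form_equiv"
  proof cases
    case 1
    then show ?thesis using q by blast
  next
    case 2
    then show ?thesis
      using shift_equiv[of 1] \<open>a \<le> c\<close> \<open>a > 0\<close> by (intro exI[of _ "Form a a c"]) auto
  next
    case 3
    then show ?thesis
      using swap_equiv \<open>\<bar>b\<bar> \<le> a\<close> \<open>a > 0\<close> by (intro exI[of _ "Form a (- b) a"]) auto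
  qed
  then show ?thesis using inD by blast
qed

text \<open>Here \<open>a'\<close> is the value of \<open>[a,b,c]\<close> at \<open>(p, r)\<close>.
  A reduced form has few values up to \<open>a\<close>, so \<open>a' \<le> a\<close> leaves only
  \<open>r = 0\<close> (a shift, up to sign) and \<open>r = 1\<close> or \<open>r = -1\<close>,
  where \<open>a = c\<close> is forced.\<close>

lemma reduced_form_eqI_aux:
  assumes red: "reduced_form (Form a b c)" "reduced_form (Form a' b' c')"
    and disc: "discriminant (Form a b c) = discriminant (Form a' b' c')"
    and det: "p * s - q * r = 1"
    and a': "a' = a * p\<^sup>2 + b * p * r + c * r\<^sup>2"
    and b': "b' = 2 * a * p * q + b * (p * s + q * r) + 2 * c * r * s"
    and "a' \<le> a"
  shows "Form a' b' c' = Form a b c"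
proof -
  have "a > 0" using red(1) by simp
  have "b\<^sup>2 \<le> a\<^sup>2"
    using red(1) by (auto simp: abs_le_square_iff[symmetric])
  have "a\<^sup>2 \<le> a * c"
    using red(1) \<open>a > 0\<close> by (simp add: power2_eq_square)
  \<comment> \<open>Reducedness gives \<open>4 * a * c - b\<^sup>2 \<ge> 3 * a\<^sup>2\<close>, so
    \<open>\<bar>r\<bar> \<ge> 2\<close> would yield \<open>4 * a * a' \<ge> 12 * a\<^sup>2\<close>,
    although \<open>a' \<le> a\<close>.\<close>
  have "\<bar>r\<bar> \<le> 1"
  proof (rule ccontr)
    assume "\<not> \<bar>r\<bar> \<le> 1"
    then have "2\<^sup>2 \<le> r\<^sup>2" using power_mono[of 2 "\<bar>r\<bar>" 2] by simp
    have "12 * a\<^sup>2 \<le> 4 * (3 * a\<^sup>2)" by simp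
    also have "\<dots> \<le> r\<^sup>2 * (4 * a * c - b\<^sup>2)"
      using \<open>2\<^sup>2 \<le> r\<^sup>2\<close> \<open>b\<^sup>2 \<le> a\<^sup>2\<close> \<open>a\<^sup>2 \<le> a * c\<close> by (intro mult_mono) auto
    also have "\<dots> \<le> (2 * a * p + b * r)\<^sup>2 + r\<^sup>2 * (4 * a * c - b\<^sup>2)"
      by simp
    also have "\<dots> = 4 * a * a'"
      unfolding a' by (simp add: power2_eq_square algebra_simps)
    also have "\<dots> \<le> 4 * a * a"
      using \<open>a' \<le> a\<close> \<open>a > 0\<close> by simp
    finally show False
      using \<open>a > 0\<close> by (simp add: power2_eq_square)
  qed
  have "a' = a \<and> b' = b"
  proof (cases "r = 0")
    case True
    then have "p * s = 1" using det by simp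
    then have "p\<^sup>2 = 1" by (auto simp: zmult_eq_1_iff)
    then have "a' = a" using a' True by simp
    have b'': "b' = b + 2 * a * (p * q)"
      using b' True \<open>p * s = 1\<close> by (simp add: algebra_simps)
    \<comment> \<open>Both \<open>b\<close> and \<open>b'\<close> lie in the half-open interval from
      \<open>- a\<close> (excluded) to \<open>a\<close>, of length \<open>2 * a\<close>, and differ
      by a multiple of \<open>2 * a\<close>.\<close>
    have "p * q = 0"
    proof (rule ccontr)
      assume "p * q \<noteq> 0"
      then have "2 * a * 1 \<le> 2 * a * \<bar>p * q\<bar>"
        using \<open>a > 0\<close> by (intro mult_left_mono, linarith+)
      also have "\<dots> = \<bar>b' - b\<bar>"
        using b'' \<open>a > 0\<close> by (simp add: abs_mult)
      finally show False
        using red \<open>a' = a\<close> by auto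
    qed
    then show ?thesis using \<open>a' = a\<close> b'' by simp
  next
    case False
    then have "r = 1 \<or> r = -1" using \<open>\<bar>r\<bar> \<le> 1\<close> by auto
    \<comment> \<open>Since \<open>r\<^sup>2 = 1\<close>, the value at \<open>(p, r)\<close> equals
      the value at \<open>(t, 1)\<close>.\<close>
    define t where "t = p * r"
    have at: "a' = a * t\<^sup>2 + b * t + c"
      using a' \<open>r = 1 \<or> r = -1\<close> by (auto simp: t_def)
    \<comment> \<open>For an integer \<open>t\<close> one has
      \<open>\<bar>t\<bar> \<le> t\<^sup>2\<close>, and \<open>\<bar>b\<bar> \<le> a\<close>; so the
      value at \<open>(t, 1)\<close> is at least \<open>c\<close>, and
      \<open>a' \<le> a \<le> c\<close> forces equality throughout.\<close>
    have "0 \<le> a * (\<bar>t\<bar> * (\<bar>t\<bar> - 1))"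
      using \<open>a > 0\<close> by (cases "t = 0") (auto intro!: mult_nonneg_nonneg)
    also have "\<dots> = a * t\<^sup>2 - a * \<bar>t\<bar>"
      by (simp add: algebra_simps power2_eq_square)
    also have "a * \<bar>t\<bar> \<ge> \<bar>b\<bar> * \<bar>t\<bar>"
      using red(1) by (intro mult_right_mono) auto
    then have "a * t\<^sup>2 - a * \<bar>t\<bar> \<le> a * t\<^sup>2 + b * t"
      by (simp add: abs_mult[symmetric])
    finally have "a * t\<^sup>2 + b * t \<ge> 0" .
    then have "c = a" "a' = a" "a * t\<^sup>2 + b * t = 0"
      using at \<open>a' \<le> a\<close> red(1) by auto
    then have "b \<ge> 0" "t * (a * t + b) = 0"
      using red(1) by (simp_all add: power2_eq_square algebra_simps)
    then have "a * t + b = 0 \<or> t = 0" by auto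
    show ?thesis
    \<comment> \<open>For \<open>t = 0\<close> the substitution is a swap combined with a shift, so
      \<open>b'\<close> is congruent to \<open>- b\<close> modulo \<open>2 * a\<close>. If
      \<open>b = a\<close>, the range of \<open>b'\<close> leaves only \<open>b' = a\<close>;
      otherwise \<open>b' = - b\<close> and \<open>c' = a\<close>, and the sign condition for equal
      outer coefficients gives \<open>b = b' = 0\<close>.\<close>
    proof (cases "t = 0")
      case True
      then have "p = 0" using False by (simp add: t_def)
      have b'': "b' = - b + 2 * a * (r * s)"
        using b' det \<open>p = 0\<close> \<open>c = a\<close> by (simp add: algebra_simps)
      show ?thesis
      proof (cases "b = a")
        case True
        have "b' = a * (2 * (r * s) - 1)"
          using b'' True by (simp add: algebra_simps)
        then have "a * (2 * (r * s) - 1) \<le> a * 1" "a * (- 1) < a * (2 * (r * s) - 1)"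
          using red(2) \<open>a' = a\<close> by simp_all
        then have "2 * (r * s) - 1 \<le> 1" "- 1 < 2 * (r * s) - 1"
          using \<open>a > 0\<close> by (simp_all only: mult_le_cancel_left_pos mult_less_cancel_left_pos)
        then have "r * s = 1" by presburger
        then show ?thesis using b'' True \<open>a' = a\<close> by simp
      next
        case False
        have "r * s = 0"
        proof (rule ccontr)
          assume "r * s \<noteq> 0"
          then have "2 * a * 1 \<le> 2 * a * \<bar>r * s\<bar>"
            using \<open>a > 0\<close> by (intro mult_left_mono, linarith+)
          also have "\<dots> = \<bar>b' + b\<bar>"
            using b'' \<open>a > 0\<close> by (simp add: abs_mult)
          finally show False
            using red \<open>a' = a\<close> False \<open>b \<ge> 0\<close> by auto
        qed
        then have "b' = - b" using b'' by simp
        then have "4 * a * c = 4 * a * c'"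
          using disc \<open>a' = a\<close> by simp
        then have "c' = a" using \<open>a > 0\<close> \<open>c = a\<close> by simp
        then show ?thesis
          using \<open>b' = - b\<close> red(2) \<open>a' = a\<close> \<open>b \<ge> 0\<close> by simp
      qed
    next
      case nz: False
      \<comment> \<open>A nonzero \<open>t\<close> makes \<open>b\<close> a positive multiple of
        \<open>a\<close>, so the form is \<open>[a,a,a]\<close>; equality of discriminants and
        \<open>c' \<ge> a\<close> then give \<open>\<bar>b'\<bar> \<ge> a\<close>.\<close>
      then have "a * (- t) = b" using \<open>a * t + b = 0 \<or> t = 0\<close> by simp
      then have "- t > 0"
        using nz \<open>b \<ge> 0\<close> \<open>a > 0\<close> zero_le_mult_iff[of a "- t"] by auto
      then have "a * (- t) \<ge> a * 1"
        using \<open>a > 0\<close> by (intro mult_left_mono) auto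
      then have "b = a" using red(1) \<open>a * (- t) = b\<close> by simp
      have "b'\<^sup>2 = 4 * (a * c') - 3 * a\<^sup>2"
        using disc \<open>b = a\<close> \<open>c = a\<close> \<open>a' = a\<close> by (simp add: power2_eq_square)
      moreover have "a * c' \<ge> a * a"
        using red(2) \<open>a' = a\<close> \<open>a > 0\<close> by simp
      ultimately have "a\<^sup>2 \<le> b'\<^sup>2" by (simp add: power2_eq_square)
      then have "\<bar>a\<bar> \<le> \<bar>b'\<bar>" by (simp add: abs_le_square_iff)
      then show ?thesis using red(2) \<open>a' = a\<close> \<open>b = a\<close> by auto
    qed
  qed
  then show ?thesis using disc \<open>a > 0\<close> by simp
qed

lemma reduced_form_unique:
  assumes "(f, g) \<in> form_equiv" "reduced_form f" "reduced_form g"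
  shows "f = g"
proof -
  \<comment> \<open>By symmetry of equivalence, the form with the smaller first coefficient may be
    taken as \<open>f\<close>.\<close>
  have *: "f = g" if *: "(f, g) \<in> form_equiv" "reduced_form f" "reduced_form g"
      "f = Form a' b' c'" "g = Form a b c" "a' \<le> a" for f g a b c a' b' c'
  proof -
    have "discriminant g = discriminant f"
      using *(1) by (auto simp: form_equiv_def discriminant_form_act)
    obtain p q r s where "p * s - q * r = 1"
      "a' = a * p\<^sup>2 + b * p * r + c * r\<^sup>2"
      "b' = 2 * a * p * q + b * (p * s + q * r) + 2 * c * r * s"
      using *(1) unfolding *(4,5) by (rule form_equivE)
    then show ?thesis
      using reduced_form_eqI_aux * \<open>discriminant g = discriminant f\<close> by metis
  qed
  obtain a b c a' b' c' where "f = Form a' b' c'" "g = Form a b c"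
    by (cases f, cases g)
  then show ?thesis
    using *[OF assms, of a' b' c' a b c] *[OF form_equiv_sym[OF assms(1)] assms(3,2), of a b c a' b' c']
    by fastforce
qed

lemma class_number_eq_card_reduced:
  assumes "D < 0"
  shows "class_number D = card {q \<in> forms D. reduced_form q}"
proof -
  have "bij_betw (\<lambda>q. form_equiv `` {q}) {q \<in> forms D. reduced_form q} (forms D // form_equiv)"
  proof (rule bij_betwI')
    fix f g assume "f \<in> {q \<in> forms D. reduced_form q}" "g \<in> {q \<in> forms D. reduced_form q}"
    then show "form_equiv `` {f} = form_equiv `` {g} \<longleftrightarrow> f = g"
      using reduced_form_unique eq_equiv_class[OF _ equiv_form_equiv] by blast
  next
    fix X assume "X \<in> forms D // form_equiv"
    then obtain f where f: "f \<in> forms D" "X = form_equiv `` {f}"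
      by (rule quotientE)
    then show "\<exists>g \<in> {q \<in> forms D. reduced_form q}. X = form_equiv `` {g}"
      using exists_reduced[OF f(1) assms] equiv_class_eq[OF equiv_form_equiv] by blast
  qed (auto intro: quotientI)
  then show ?thesis
    by (simp add: class_number_def forms_def[symmetric] bij_betw_same_card)
qed

section \<open>Selling parameters: reduced forms with nonnegative middle coefficient as
  triples\<close>

text \<open>For odd \<open>D\<close> the divisions by 2 are exact only on triples of odd numbers, and for even \<open>D\<close>
  those in \<open>form_triple\<close> only if \<open>b\<close> is even.\<close>

fun triple_form :: "int \<Rightarrow> int \<times> int \<times> int \<Rightarrow> bqf" where
  "triple_form D (e, f, g) =
     (if odd D then Form ((f + g) div 2) g ((e + g) div 2) else Form (f + g) (2 * g) (e + g))"

fun form_triple :: "int \<Rightarrow> bqf \<Rightarrow> int \<times> int \<times> int" where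
  "form_triple D (Form a b c) =
     (if odd D then (2 * c - b, 2 * a - b, b) else (c - b div 2, a - b div 2, b div 2))"

definition triples :: "int \<Rightarrow> int \<Rightarrow> (int \<times> int \<times> int) set" where
  "triples D n = {(e, f, g). e \<ge> f \<and> f \<ge> g \<and> g \<ge> 0 \<and> e * f + e * g + f * g = n \<and>
     gcd e (gcd f g) = 1 \<and>
     (if odd D then odd e \<and> odd f \<and> odd g else \<not> (odd e \<and> odd f \<and> odd g))}"

fun nonneg_reduced :: "bqf \<Rightarrow> bool" where
  "nonneg_reduced (Form a b c) \<longleftrightarrow> 0 \<le> b \<and> b \<le> a \<and> a \<le> c"

text \<open>A common divisor of the coefficients divides \<open>2 * e\<close>, \<open>2 * f\<close>
  and \<open>2 * g\<close>; if odd, it divides \<open>e\<close>, \<open>f\<close>, \<open>g\<close>.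
  An even one forces \<open>e\<close>, \<open>f\<close>, \<open>g\<close> to have the same parity:
  all odd is excluded, all even contradicts gcd 1. Conversely, if all three are odd, 2 divides every
  coefficient.\<close>

lemma primitive_even_iff:
  "primitive_form (Form (f + g) (2 * g) (e + g)) \<longleftrightarrow>
     gcd e (gcd f g) = 1 \<and> \<not> (odd e \<and> odd f \<and> odd g)"
proof -
  have gcd: "gcd e (gcd f g) = 1 \<longleftrightarrow> (\<forall>d. d dvd e \<and> d dvd f \<and> d dvd g \<longrightarrow> is_unit d)"
    using primitive_form_iff[of e f g] by simp
  show ?thesis
    unfolding primitive_form_iff gcd
  proof (intro iffI conjI allI impI)
    fix d assume *: "\<forall>d. d dvd f + g \<and> d dvd 2 * g \<and> d dvd e + g \<longrightarrow> is_unit d"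
      and "d dvd e \<and> d dvd f \<and> d dvd g"
    then show "is_unit d" by auto
  next
    assume *: "\<forall>d. d dvd f + g \<and> d dvd 2 * g \<and> d dvd e + g \<longrightarrow> is_unit d"
    then have "\<not> (even (f + g) \<and> even (e + g))"
      by (metis dvd_triv_left odd_one)
    then show "\<not> (odd e \<and> odd f \<and> odd g)" by auto
  next
    fix d assume *: "(\<forall>d. d dvd e \<and> d dvd f \<and> d dvd g \<longrightarrow> is_unit d) \<and> \<not> (odd e \<and> odd f \<and> odd g)"
      and d: "d dvd f + g \<and> d dvd 2 * g \<and> d dvd e + g"
    have "d dvd 2 * (f + g) - 2 * g" "d dvd 2 * (e + g) - 2 * g"
      using d by (meson dvd_diff dvd_mult)+
    then have "d dvd 2 * f" "d dvd 2 * e" by simp_all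
    have "odd d"
    proof
      assume "even d"
      then have "even (f + g)" "even (e + g)" using d dvd_trans by blast+
      then have "even e" "even f" "even g" using * by auto
      then show False using * by (metis odd_one)
    qed
    then have "coprime d 2" by simp
    then have "d dvd e" "d dvd f" "d dvd g"
      using d \<open>d dvd 2 * f\<close> \<open>d dvd 2 * e\<close> coprime_dvd_mult_right_iff by blast+
    then show "is_unit d" using * by blast
  qed
qed

text \<open>Divisors of the odd number \<open>g\<close> are odd, so the factor 2 in the two
  equations can be cancelled.\<close>

lemma primitive_odd_iff:
  assumes "2 * a = f + g" "2 * c = e + g" "odd g"
  shows "primitive_form (Form a g c) \<longleftrightarrow> gcd e (gcd f g) = 1"
proof -
  have gcd: "gcd e (gcd f g) = 1 \<longleftrightarrow> (\<forall>d. d dvd e \<and> d dvd f \<and> d dvd g \<longrightarrow> is_unit d)"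
    using primitive_form_iff[of e f g] by simp
  have "d dvd a \<and> d dvd c \<longleftrightarrow> d dvd e \<and> d dvd f" if "d dvd g" for d
  proof -
    have "odd d" using that \<open>odd g\<close> dvd_trans by blast
    then have "coprime d 2" by simp
    then have "d dvd a \<longleftrightarrow> d dvd 2 * a" "d dvd c \<longleftrightarrow> d dvd 2 * c"
      by (auto simp: coprime_dvd_mult_right_iff)
    then show ?thesis
      using that unfolding assms(1,2) by (auto simp: dvd_add_left_iff)
  qed
  then show ?thesis unfolding primitive_form_iff gcd by blast
qed

text \<open>The relations between \<open>a\<close>, \<open>c\<close> and \<open>e\<close>,
  \<open>f\<close> are stated without division, so that the lemma serves both the map from triples
  to forms and its inverse.\<close>

lemma forms_iff_triples_odd:
  assumes "odd D" "n = - D" "2 * a = f + g" "2 * c = e + g" "odd e" "odd f" "odd g"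
  shows "Form a g c \<in> forms D \<and> nonneg_reduced (Form a g c) \<longleftrightarrow> (e, f, g) \<in> triples D n"
proof -
  have "g\<^sup>2 - 4 * a * c = g\<^sup>2 - (2 * a) * (2 * c)" by simp
  also have "\<dots> = - (e * f + e * g + f * g)"
    unfolding assms(3,4) by (simp add: power2_eq_square algebra_simps)
  finally have "discriminant (Form a g c) = - (e * f + e * g + f * g)" by simp
  moreover have "f \<ge> g \<longleftrightarrow> g \<le> a" "e \<ge> f \<longleftrightarrow> a \<le> c"
    using assms by linarith+
  ultimately show ?thesis
    using assms primitive_odd_iff[OF assms(3,4,7)]
    by (auto simp: forms_def triples_def simp del: primitive_form.simps discriminant.simps)
qed

lemma forms_iff_triples_even:
  assumes "even D" "4 * n = - D"
  shows "Form (f + g) (2 * g) (e + g) \<in> forms D \<and> nonneg_reduced (Form (f + g) (2 * g) (e + g))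
    \<longleftrightarrow> (e, f, g) \<in> triples D n"
proof -
  have "discriminant (Form (f + g) (2 * g) (e + g)) = - 4 * (e * f + e * g + f * g)"
    by (simp add: power2_eq_square algebra_simps)
  then show ?thesis
    using assms primitive_even_iff[of f g e]
    by (auto simp: forms_def triples_def simp del: primitive_form.simps discriminant.simps)
qed

lemma bij_betw_triple_form:
  assumes "D mod 4 = 0 \<or> D mod 4 = 1" "D < 0" "n = (if odd D then \<bar>D\<bar> else \<bar>D\<bar> div 4)"
  shows "bij_betw (triple_form D) (triples D n) {q \<in> forms D. nonneg_reduced q}"
proof (cases "odd D")
  case True
  then have n: "n = - D" using assms by simp
  \<comment> \<open>\<open>D = b\<^sup>2 - 4 * a * c\<close> has the parity of \<open>b\<close>,
    whence \<open>2 * c - b\<close>, \<open>2 * a - b\<close> and \<open>b\<close> are all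
    odd.\<close>
  have odd_b: "odd b" if "Form a b c \<in> forms D" for a b c
    using that True by (auto simp: forms_def)
  show ?thesis
  proof (rule bij_betw_byWitness[where f' = "form_triple D"])
    show "\<forall>x \<in> triples D n. form_triple D (triple_form D x) = x"
      using True by (auto simp: triples_def)
    show "\<forall>q \<in> {q \<in> forms D. nonneg_reduced q}. triple_form D (form_triple D q) = q"
    proof
      fix q assume "q \<in> {q \<in> forms D. nonneg_reduced q}"
      then show "triple_form D (form_triple D q) = q" using True by (cases q) auto
    qed
    show "triple_form D ` triples D n \<subseteq> {q \<in> forms D. nonneg_reduced q}"
    proof (intro image_subsetI)
      fix x assume x: "x \<in> triples D n"
      obtain e f g where efg: "x = (e, f, g)" by (cases x)
      then have "odd e" "odd f" "odd g" using x True by (auto simp: triples_def)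
      then show "triple_form D x \<in> {q \<in> forms D. nonneg_reduced q}"
        using forms_iff_triples_odd[OF True n, of "(f + g) div 2" f g "(e + g) div 2" e] x efg True
        by simp
    qed
    show "form_triple D ` {q \<in> forms D. nonneg_reduced q} \<subseteq> triples D n"
    proof (intro image_subsetI)
      fix q assume q: "q \<in> {q \<in> forms D. nonneg_reduced q}"
      obtain a b c where abc: "q = Form a b c" by (cases q)
      then have "odd b" using q odd_b by auto
      then show "form_triple D q \<in> triples D n"
        using forms_iff_triples_odd[OF True n, of a "2 * a - b" b c "2 * c - b"] q abc True
        by simp
    qed
  qed
next
  case False
  then have "D mod 4 = 0" using assms(1) by presburger
  then have n: "4 * n = - D" using assms(2,3) False by presburger
  have ev: "even D" using False by simp
  have even_b: "even b" if "Form a b c \<in> forms D" for a b c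
    using that ev by (auto simp: forms_def)
  show ?thesis
  proof (rule bij_betw_byWitness[where f' = "form_triple D"])
    show "\<forall>x \<in> triples D n. form_triple D (triple_form D x) = x"
      using ev by (auto simp: triples_def)
    show "\<forall>q \<in> {q \<in> forms D. nonneg_reduced q}. triple_form D (form_triple D q) = q"
    proof
      fix q assume "q \<in> {q \<in> forms D. nonneg_reduced q}"
      then show "triple_form D (form_triple D q) = q" using ev even_b by (cases q) auto
    qed
    show "triple_form D ` triples D n \<subseteq> {q \<in> forms D. nonneg_reduced q}"
    proof (intro image_subsetI)
      fix x assume x: "x \<in> triples D n"
      obtain e f g where efg: "x = (e, f, g)" by (cases x)
      then show "triple_form D x \<in> {q \<in> forms D. nonneg_reduced q}"
        using forms_iff_triples_even[OF ev n, of f g e] x ev by simp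
    qed
    show "form_triple D ` {q \<in> forms D. nonneg_reduced q} \<subseteq> triples D n"
    proof (intro image_subsetI)
      fix q assume q: "q \<in> {q \<in> forms D. nonneg_reduced q}"
      obtain a b c where abc: "q = Form a b c" by (cases q)
      then have "even b" using q even_b by auto
      then show "form_triple D q \<in> triples D n"
        using forms_iff_triples_even[OF ev n, of "a - b div 2" "b div 2" "c - b div 2"] q abc ev
        by simp
    qed
  qed
qed

section \<open>Counting reduced forms by triples\<close>

lemma finite_triples:
  assumes "n > 0"
  shows "finite (triples D n)"
proof (rule finite_subset)
  show "triples D n \<subseteq> {0..n} \<times> {0..n} \<times> {0..n}"
  proof
    fix x assume x: "x \<in> triples D n"
    obtain e f g where efg: "x = (e, f, g)" by (cases x)
    have *: "e \<ge> f" "f \<ge> g" "g \<ge> 0" "e * f + e * g + f * g = n"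
      using x efg by (auto simp: triples_def)
    have "f \<noteq> 0" using * assms by auto
    then have "e * 1 \<le> e * f" using * by (intro mult_left_mono) auto
    moreover have "e * g \<ge> 0" "f * g \<ge> 0" using * by auto
    ultimately have "e \<le> n" using * by linarith
    then show "x \<in> {0..n} \<times> {0..n} \<times> {0..n}" using * efg by auto
  qed
qed simp

fun opposite :: "bqf \<Rightarrow> bqf" where
  "opposite (Form a b c) = Form a (- b) c"

fun strictly_reduced :: "bqf \<Rightarrow> bool" where
  "strictly_reduced (Form a b c) \<longleftrightarrow> 0 < b \<and> b < a \<and> a < c"

definition strict_triples :: "int \<Rightarrow> int \<Rightarrow> (int \<times> int \<times> int) set" where
  "strict_triples D n = triples D n \<inter> {(e, f, g). e > f \<and> f > g \<and> g > 0}"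

text \<open>If \<open>b < 0\<close>, the strict bound \<open>- a < b\<close> and the sign condition
  for \<open>a = c\<close> make \<open>[a,-b,c]\<close> strictly reduced. Conversely, a negative
  discriminant excludes \<open>a = 0\<close>, so \<open>b \<ge> 0\<close> implies
  \<open>- a < b\<close>.\<close>

lemma reduced_form_cases:
  assumes "D < 0"
  shows "{q \<in> forms D. reduced_form q} =
    {q \<in> forms D. nonneg_reduced q} \<union> opposite ` {q \<in> forms D. strictly_reduced q}"
proof (intro set_eqI iffI)
  fix q assume q: "q \<in> {q \<in> forms D. reduced_form q}"
  obtain a b c where abc: "q = Form a b c" by (cases q)
  show "q \<in> {q \<in> forms D. nonneg_reduced q} \<union> opposite ` {q \<in> forms D. strictly_reduced q}"
  proof (cases "b \<ge> 0")
    case True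
    then show ?thesis using q abc by auto
  next
    case False
    then have "opposite q \<in> {q \<in> forms D. strictly_reduced q}"
      using q abc by (auto simp: forms_def)
    moreover have "q = opposite (opposite q)" using abc by simp
    ultimately show ?thesis by blast
  qed
next
  fix q assume "q \<in> {q \<in> forms D. nonneg_reduced q} \<union> opposite ` {q \<in> forms D. strictly_reduced q}"
  then consider "q \<in> forms D" "nonneg_reduced q"
    | r where "r \<in> forms D" "strictly_reduced r" "q = opposite r" by blast
  then show "q \<in> {q \<in> forms D. reduced_form q}"
  proof cases
    case 1
    obtain a b c where abc: "q = Form a b c" by (cases q)
    have "a \<noteq> 0" using 1 abc assms by (auto simp: forms_def)
    then show ?thesis using 1 abc by auto
  next
    case 2
    then show ?thesis by (cases r) (auto simp: forms_def)
  qed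
qed

lemma class_number_eq_card_triples:
  assumes D: "D mod 4 = 0 \<or> D mod 4 = 1" "D < 0" "n = (if odd D then \<bar>D\<bar> else \<bar>D\<bar> div 4)"
  shows "class_number D = card (triples D n) + card (strict_triples D n)"
proof -
  let ?N = "{q \<in> forms D. nonneg_reduced q}" and ?S = "{q \<in> forms D. strictly_reduced q}"
  have bij: "bij_betw (triple_form D) (triples D n) ?N"
    using D by (rule bij_betw_triple_form)
  have "n > 0" using D by presburger
  then have fin: "finite ?N"
    using bij finite_triples bij_betw_finite by blast
  \<comment> \<open>In both parities \<open>b < a\<close> means \<open>g < f\<close> and
    \<open>a < c\<close> means \<open>f < e\<close>.\<close>
  have strict: "strictly_reduced (triple_form D x) \<longleftrightarrow> x \<in> strict_triples D n"
    if "x \<in> triples D n" for x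
    using that by (cases "odd D") (auto simp: strict_triples_def triples_def elim!: oddE)
  have "?S \<subseteq> ?N"
  proof
    fix q assume "q \<in> ?S" then show "q \<in> ?N" by (cases q) auto
  qed
  have "triple_form D ` strict_triples D n = ?S"
  proof (intro equalityI subsetI)
    fix q assume "q \<in> ?S"
    then have "q \<in> triple_form D ` triples D n"
      using \<open>?S \<subseteq> ?N\<close> bij by (auto simp: bij_betw_def)
    then show "q \<in> triple_form D ` strict_triples D n"
      using strict \<open>q \<in> ?S\<close> by auto
  next
    fix q assume "q \<in> triple_form D ` strict_triples D n"
    then obtain x where x: "x \<in> strict_triples D n" "q = triple_form D x" by blast
    then have "x \<in> triples D n" by (simp add: strict_triples_def)
    then show "q \<in> ?S" using strict x bij by (auto simp: bij_betw_def)
  qed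
  moreover have "strict_triples D n \<subseteq> triples D n" by (simp add: strict_triples_def)
  ultimately have "bij_betw (triple_form D) (strict_triples D n) ?S"
    using bij bij_betw_subset by blast
  then have cardS: "card ?S = card (strict_triples D n)"
    by (simp add: bij_betw_same_card)
  have "inj_on opposite ?S"
  proof (rule inj_onI)
    fix q r assume "opposite q = opposite r" then show "q = r" by (cases q, cases r) auto
  qed
  then have "card (opposite ` ?S) = card ?S" by (rule card_image)
  moreover have "?N \<inter> opposite ` ?S = {}"
  proof -
    have "\<not> nonneg_reduced (opposite q)" if "strictly_reduced q" for q
      using that by (cases q) auto
    then show ?thesis by auto
  qed
  moreover have "finite ?S" using fin \<open>?S \<subseteq> ?N\<close> finite_subset by blast
  ultimately have "card (?N \<union> opposite ` ?S) = card ?N + card ?S"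
    using fin by (simp add: card_Un_disjoint)
  then show ?thesis
    using class_number_eq_card_reduced[OF D(2)] reduced_form_cases[OF D(2)] cardS
      bij_betw_same_card[OF bij] by simp
qed

section \<open>Triples with a repeated entry or a zero\<close>

text \<open>The repeated entry is \<open>e\<close>: the triple \<open>e, e, f\<close> has
  \<open>e * e + e * f + e * f = e\<^sup>2 + 2 * e * f\<close>.\<close>

definition isosceles_pairs :: "int \<Rightarrow> int \<Rightarrow> (int \<times> int) set" where
  "isosceles_pairs D n = {(e, f). e > 0 \<and> f > 0 \<and> e\<^sup>2 + 2 * e * f = n \<and> gcd e f = 1 \<and>
     (if odd D then odd e \<and> odd f else \<not> (odd e \<and> odd f))}"

definition factor_pairs :: "int \<Rightarrow> (int \<times> int) set" where
  "factor_pairs n = {(e, f). e > f \<and> f > 0 \<and> e * f = n \<and> gcd e f = 1}"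

lemma card_isosceles_pairs:
  assumes "odd D \<longrightarrow> n \<noteq> 3"
  shows "card (isosceles_pairs D n) =
    card (triples D n \<inter> {(e, f, g). (e = f \<or> f = g) \<and> g > 0})"
proof (rule bij_betw_same_card)
  \<comment> \<open>Sorts the entries \<open>e, e, f\<close> in decreasing order.\<close>
  let ?h = "\<lambda>(e, f). if f < e then (e, e, f) else (f, e, e :: int)"
  \<comment> \<open>Equal entries with gcd 1 are both 1, which gives \<open>n = 3\<close> and, by
    the parity condition, odd \<open>D\<close>.\<close>
  have neq: "e \<noteq> f" if "(e, f) \<in> isosceles_pairs D n" for e f
  proof
    assume "e = f"
    then have "e = 1" using that by (auto simp: isosceles_pairs_def)
    then show False using that \<open>e = f\<close> assms by (auto simp: isosceles_pairs_def split: if_splits)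
  qed
  show "bij_betw ?h (isosceles_pairs D n) (triples D n \<inter> {(e, f, g). (e = f \<or> f = g) \<and> g > 0})"
    unfolding bij_betw_def
  proof (intro conjI equalityI subsetI)
    show "inj_on ?h (isosceles_pairs D n)"
      using neq by (auto simp: inj_on_def split: if_splits)
  next
    fix x assume "x \<in> ?h ` isosceles_pairs D n"
    then show "x \<in> triples D n \<inter> {(e, f, g). (e = f \<or> f = g) \<and> g > 0}"
      by (auto simp: isosceles_pairs_def triples_def power2_eq_square algebra_simps
          gcd.commute[of e f for e f :: int] coprime_commute split: if_splits)
  next
    fix x assume x: "x \<in> triples D n \<inter> {(e, f, g). (e = f \<or> f = g) \<and> g > 0}"
    obtain e f g where efg: "x = (e, f, g)" by (cases x)
    show "x \<in> ?h ` isosceles_pairs D n"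
    proof (cases "e = f")
      case True
      then have "(e, g) \<in> isosceles_pairs D n"
        using x efg by (auto simp: isosceles_pairs_def triples_def power2_eq_square algebra_simps
            split: if_splits)
      moreover have "g < e" using neq[OF calculation] x efg by (auto simp: triples_def)
      ultimately show ?thesis
        using True efg by (intro image_eqI[of _ _ "(e, g)"]) auto
    next
      case False
      then have "(f, e) \<in> isosceles_pairs D n"
        using x efg by (auto simp: isosceles_pairs_def triples_def power2_eq_square algebra_simps
            gcd.commute split: if_splits)
      moreover have "f < e" "f = g" using False x efg by (auto simp: triples_def)
      ultimately show ?thesis
        using efg by (intro image_eqI[of _ _ "(f, e)"]) auto
    qed
  qed
qed

text \<open>Since 0 is even, the parity condition for even \<open>D\<close> holds automatically when
  \<open>g = 0\<close>. Coprime \<open>e = f\<close> would give \<open>n = 1\<close>, so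
  \<open>e \<ge> f\<close> is strict.\<close>

lemma card_factor_pairs:
  assumes "even D" "n > 1"
  shows "card (factor_pairs n) = card (triples D n \<inter> {(e, f, g). g = 0})"
proof (rule bij_betw_same_card)
  have neq: "e \<noteq> f" if "e * f = n" "gcd e f = 1" for e f
  proof
    assume "e = f"
    then have "\<bar>f\<bar> * \<bar>f\<bar> = 1" using that by simp
    then show False using that assms \<open>e = f\<close> by simp
  qed
  show "bij_betw (\<lambda>(e, f). (e, f, 0)) (factor_pairs n) (triples D n \<inter> {(e, f, g). g = 0})"
    unfolding bij_betw_def
  proof (intro conjI equalityI subsetI)
    fix x assume x: "x \<in> triples D n \<inter> {(e, f, g). g = 0}"
    obtain e f g where efg: "x = (e, f, g)" by (cases x)
    then have *: "e \<ge> f" "f \<ge> 0" "g = 0" "e * f = n" "gcd e f = 1"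
      using x by (auto simp: triples_def)
    then have "f \<noteq> 0" using assms by auto
    moreover have "e \<noteq> f" by (rule neq[OF *(4,5)])
    ultimately have "(e, f) \<in> factor_pairs n" using * by (auto simp: factor_pairs_def)
    then show "x \<in> (\<lambda>(e, f). (e, f, 0)) ` factor_pairs n"
      using efg * by (intro image_eqI[of _ _ "(e, f)"]) auto
  qed (use assms in \<open>auto simp: inj_on_def factor_pairs_def triples_def\<close>)
qed

text \<open>Triples are sorted into three disjoint kinds: \<open>e > f > g > 0\<close>, a repetition
  with \<open>g > 0\<close>, and \<open>g = 0\<close>. The last is empty for odd \<open>D\<close>,
  where \<open>g\<close> is odd.\<close>

lemma card_triples:
  assumes "n > 0" "if odd D then n \<noteq> 3 else n \<noteq> 1"
  shows "card (triples D n) = card (strict_triples D n) + card (isosceles_pairs D n)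
    + (if even D then card (factor_pairs n) else 0)"
proof -
  let ?I = "triples D n \<inter> {(e, f, g). (e = f \<or> f = g) \<and> g > 0}"
  let ?Z = "triples D n \<inter> {(e, f, g). g = 0}"
  have fin: "finite (triples D n)" using assms(1) by (rule finite_triples)
  have "triples D n = strict_triples D n \<union> ?I \<union> ?Z"
  proof -
    have "e \<ge> f \<and> f \<ge> g \<and> g \<ge> 0" if "(e, f, g) \<in> triples D n" for e f g
      using that by (simp add: triples_def)
    then show ?thesis unfolding strict_triples_def by force
  qed
  also have "card \<dots> = card (strict_triples D n \<union> ?I) + card ?Z"
    using fin by (intro card_Un_disjoint) (auto simp: strict_triples_def)
  also have "card (strict_triples D n \<union> ?I) = card (strict_triples D n) + card ?I"
    using fin by (intro card_Un_disjoint) (auto simp: strict_triples_def)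
  finally have "card (triples D n) = card (strict_triples D n) + card ?I + card ?Z" .
  moreover have "card ?I = card (isosceles_pairs D n)"
    using assms card_isosceles_pairs[of D n] by auto
  moreover have "card ?Z = (if even D then card (factor_pairs n) else 0)"
  proof (cases "even D")
    case True
    then show ?thesis using card_factor_pairs[of D n] assms by simp
  next
    case False
    then have "?Z = {}" by (auto simp: triples_def)
    then show ?thesis using False by simp
  qed
  ultimately show ?thesis by simp
qed

section \<open>The discriminants -3 and -4 and the final formula\<close>

lemma triples_minus_3: "triples (-3) 3 = {(1, 1, 1)}"
proof (intro equalityI subsetI)
  fix x assume x: "x \<in> triples (-3) 3"
  obtain e f g where efg: "x = (e, f, g)" by (cases x)
  have "g \<noteq> 0" using x efg by (auto simp: triples_def)
  then have *: "e \<ge> f" "f \<ge> g" "g > 0" "e * f + e * g + f * g = 3"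
    using x efg by (simp_all add: triples_def)
  \<comment> \<open>The sum of the three bounds is \<open>2 * e + 1 \<le> 3\<close>.\<close>
  have "e * 1 \<le> e * f" "e * 1 \<le> e * g" "1 * 1 \<le> f * g"
    using * by (intro mult_mono; linarith)+
  then have "e = 1" using * by linarith
  then show "x \<in> {(1, 1, 1)}" using * efg by auto
qed (auto simp: triples_def)

lemma triples_minus_4: "triples (-4) 1 = {(1, 1, 0)}"
proof (intro equalityI subsetI)
  fix x assume x: "x \<in> triples (-4) 1"
  obtain e f g where efg: "x = (e, f, g)" by (cases x)
  have *: "e \<ge> f" "f \<ge> g" "g \<ge> 0" "e * f + e * g + f * g = 1"
    using x efg by (auto simp: triples_def)
  then have "f \<noteq> 0" by auto
  then have "e * 1 \<le> e * f" "e * g \<ge> 0" "f * g \<ge> 0"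
    using * by (auto intro!: mult_mono)
  then have "e = 1" "f = 1" using * \<open>f \<noteq> 0\<close> by linarith+
  then show "x \<in> {(1, 1, 0)}" using * efg by auto
qed (auto simp: triples_def)

lemma strict_triples_eq:
  "strict_triples D n = {(e, f, g). e > f \<and> f > g \<and> g > 0 \<and>
     e * f + e * g + f * g = n \<and> gcd e (gcd f g) = 1 \<and>
     (if odd D then odd e \<and> odd f \<and> odd g else \<not> (odd e \<and> odd f \<and> odd g))}"
  unfolding strict_triples_def triples_def by fastforce

text \<open>Strict triples are counted once among all triples and once more for the opposite forms.
  The bound \<open>D < -4\<close> excludes \<open>n = 3\<close> for odd \<open>D\<close> and
  \<open>n = 1\<close> for even \<open>D\<close>.\<close>

lemma class_number_eq:
  assumes "D mod 4 = 0 \<or> D mod 4 = 1" "D < -4" "n = (if odd D then \<bar>D\<bar> else \<bar>D\<bar> div 4)"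
  shows "class_number D = 2 * card (strict_triples D n) + card (isosceles_pairs D n)
    + (if even D then card (factor_pairs n) else 0)"
proof -
  have "n > 0 \<and> (if odd D then n \<noteq> 3 else n \<noteq> 1)"
  proof (cases "odd D")
    case True
    then have "n = - D" using assms by auto
    then show ?thesis using assms True by auto
  next
    case False
    then have "4 dvd D" using assms(1) by presburger
    then obtain m where "D = 4 * m" by blast
    then show ?thesis using assms by auto
  qed
  then show ?thesis
    using class_number_eq_card_triples[OF assms(1) _ assms(3)] card_triples[of n D] assms(2) by simp
qed

theorem theorem5p1:
  shows "class_number (-3) = 1 \<and> class_number (-4) = 1 \<and>
    (\<forall>D n :: int. (D mod 4 = 0 \<or> D mod 4 = 1) \<and> D < -4 \<and>
        n = (if odd D then \<bar>D\<bar> else \<bar>D\<bar> div 4) \<longrightarrow>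
      class_number D =
          2 * card {(e :: int, f :: int, g :: int).
                 e > f \<and> f > g \<and> g > 0 \<and> e * f + e * g + f * g = n \<and>
                 gcd e (gcd f g) = 1 \<and>
                 (if odd D then odd e \<and> odd f \<and> odd g else \<not> (odd e \<and> odd f \<and> odd g))}
        + card {(e :: int, f :: int).
                 e > 0 \<and> f > 0 \<and> e\<^sup>2 + 2 * e * f = n \<and> gcd e f = 1 \<and>
                 (if odd D then odd e \<and> odd f else \<not> (odd e \<and> odd f))}
        + (if even D
           then card {(e :: int, f :: int).
                 e > f \<and> f > 0 \<and> e * f = n \<and> gcd e f = 1}
           else 0))"
proof (intro conjI allI impI, goal_cases)
  case 1
  \<comment> \<open>The only triple \<open>(1, 1, 1)\<close> is not strict, so it accounts for
    exactly one reduced form; likewise \<open>(1, 1, 0)\<close> for \<open>D = -4\<close>.\<close>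
  show ?case
    using class_number_eq_card_triples[of "-3" 3] by (simp add: strict_triples_def triples_minus_3)
next
  case 2
  show ?case
    using class_number_eq_card_triples[of "-4" 1] by (simp add: strict_triples_def triples_minus_4)
next
  case (3 D n)
  show ?case
    by (rule class_number_eq[unfolded strict_triples_eq isosceles_pairs_def factor_pairs_def])
      (insert 3, elim conjE, assumption)+
qed

end
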